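(* Let $\gamma_n=\gamma n^{-\beta}$ with $\gamma>0$, $\beta\in(0,1)$, and let $p\in\mathbb{N}^\star$. Assume that there is $\alpha>0$ such that $D^2f(x)-\alpha I_d\ge0$ (as a quadratic form) for all $x\in\mathbb{R}^d$, and that $x\mapsto D^2f(x)$ is bounded and Lipschitz. Assume that a constant $\Sigma_p$ exists such that for any $n\in\mathbb{N}$, $$\mathbb{E}\left[|\Delta M_{n+1}|^{2p}\mid\mathcal{F}_n\right]\le\Sigma_p\,(1+f(\theta_n))^p\qquad\text{a.s.}$$ Then $(\theta_n)_{n\ge1}$ is $(L^p,\sqrt{\gamma_n})$-consistent: a constant $C_p$ exists such that, for all $n\ge1$, $$\mathbb{E}|\theta_n-\theta^\star|^p\le C_p\{\gamma_n\}^{p/2}.$$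
   Context: Setting. $f:\mathbb{R}^d\to\mathbb{R}$ is of class $\mathcal{C}^2$, $\lim_{|x|\to+\infty}f(x)=+\infty$, $\{x:\nabla f(x)=0\}=\{\theta^\star\}$ (so $\theta^\star$ is the unique minimizer of $f$), and $f(\theta^\star)=0$. There are a measurable function $\Lambda:\mathbb{R}^d\times\mathbb{R}^{k}\to\mathbb{R}^d$ and an i.i.d. sequence $(Z_n)_{n\ge1}$ of $\mathbb{R}^{k}$-valued random variables such that $\nabla f(\theta)=\mathbb{E}[\Lambda(\theta,Z_1)]$ for all $\theta\in\mathbb{R}^d$. Given $\theta_0\in\mathbb{R}^d$ and positive step sizes $(\gamma_n)_{n\ge1}$, the stochastic gradient sequence is $\theta_{n+1}=\theta_n-\gamma_{n+1}\Lambda(\theta_n,Z_{n+1})$, $n\ge0$. Set $\Delta M_{n+1}=\nabla f(\theta_n)-\Lambda(\theta_n,Z_{n+1})$, so that $\theta_{n+1}=\theta_n-\gamma_{n+1}\nabla f(\theta_n)+\gamma_{n+1}\Delta M_{n+1}$. The filtration is $\mathcal{F}_n=\sigma(\theta_1,\dots,\theta_n)$ ($\mathcal{F}_0$ trivial). $|\cdot|$ is the Euclidean norm, $D^2f$ the Hessian of $f$, $I_d$ the identity matrix. *)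

theory Defs
  imports "HOL-Probability.Probability"
begin

definition gradient :: "(real ^ 'd \<Rightarrow> real) \<Rightarrow> real ^ 'd \<Rightarrow> real ^ 'd"
  where "gradient f x = (THE D. GDERIV f x :> D)"

definition hessian :: "(real ^ 'd \<Rightarrow> real) \<Rightarrow> real ^ 'd \<Rightarrow> real ^ 'd ^ 'd"
  where "hessian f x = matrix (frechet_derivative (gradient f) (at x))"

(* The two differentiability clauses ensure that gradient f and hessian f are genuine
   derivatives and not arbitrary values of THE / SOME. *)
definition class_C2 :: "(real ^ 'd \<Rightarrow> real) \<Rightarrow> bool"
  where "class_C2 f \<longleftrightarrow>
    (\<forall>x. f differentiable at x) \<and>
    (\<forall>x. gradient f differentiable at x) \<and>
    continuous_on UNIV (hessian f)"

primrec sgd ::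
  "((real ^ 'd) \<times> (real ^ 'k) \<Rightarrow> real ^ 'd) \<Rightarrow> (nat \<Rightarrow> real) \<Rightarrow> (nat \<Rightarrow> 'w \<Rightarrow> real ^ 'k)
     \<Rightarrow> real ^ 'd \<Rightarrow> nat \<Rightarrow> 'w \<Rightarrow> real ^ 'd"
  where
    "sgd \<Lambda> \<gamma> Z \<theta>\<^sub>0 0 = (\<lambda>\<omega>. \<theta>\<^sub>0)"
  | "sgd \<Lambda> \<gamma> Z \<theta>\<^sub>0 (Suc n) = (\<lambda>\<omega>. sgd \<Lambda> \<gamma> Z \<theta>\<^sub>0 n \<omega>
       - \<gamma> (Suc n) *\<^sub>R \<Lambda> (sgd \<Lambda> \<gamma> Z \<theta>\<^sub>0 n \<omega>, Z (Suc n) \<omega>))"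

(* This is \<Delta>M_n, meaningful for n \<ge> 1. *)
definition sgd_noise ::
  "(real ^ 'd \<Rightarrow> real) \<Rightarrow> ((real ^ 'd) \<times> (real ^ 'k) \<Rightarrow> real ^ 'd) \<Rightarrow> (nat \<Rightarrow> 'w \<Rightarrow> real ^ 'k)
     \<Rightarrow> (nat \<Rightarrow> 'w \<Rightarrow> real ^ 'd) \<Rightarrow> nat \<Rightarrow> 'w \<Rightarrow> real ^ 'd"
  where "sgd_noise f \<Lambda> Z \<theta> n \<omega> =
    gradient f (\<theta> (n - 1) \<omega>) - \<Lambda> (\<theta> (n - 1) \<omega>, Z n \<omega>)"

(* \<sigma>(X_1, ..., X_n) as a sub-sigma-algebra of M. The generators are spelled out instead of
   using a supremum of vimage_algebra's because the empty supremum has empty space; here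
   n = 0 gives the trivial sigma-algebra on space M. *)
definition gen_filtration :: "'w measure \<Rightarrow> (nat \<Rightarrow> 'w \<Rightarrow> real ^ 'd) \<Rightarrow> nat \<Rightarrow> 'w measure"
  where "gen_filtration M X n =
    sigma (space M) (\<Union>i\<in>{1..n}. {X i -` A \<inter> space M | A. A \<in> sets borel})"

end

(* With u_n = E|theta_n - theta*|^(2p), expand |y + gamma m|^(2p), where y is the deterministic
   gradient step from theta_n and m the noise.  Strong convexity contracts |y|^(2p) by
   1 - alpha gamma; the term linear in m has mean zero because theta_n and Z_(n+1) are independent.
   The quadratic term gamma^2 |y|^(2p-2) |m|^2 is split pointwise by Young's inequality into
   eta gamma |y|^(2p) + C gamma^(p+1) |m|^(2p), so that only the unconditional 2p-th moment of m
   enters; it is at most S (1 + u_n), as f grows at most quadratically.  This gives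
   u_(n+1) <= (1 - a gamma_(n+1)) u_n + D gamma_(n+1)^(p+1) eventually, hence u_n = O(gamma_n^p)
   because gamma_n / gamma_(n+1) = 1 + o(gamma_(n+1)) for beta < 1. *)
theory Submission
  imports Defs "HOL-Real_Asymp.Real_Asymp"
begin

section \<open>Gradient and Hessian: monotonicity, Lipschitz bound, quadratic growth\<close>

text \<open>\<open>gradient\<close> is a definite description, so existence and uniqueness are both
  needed. The vector is read off from the values of the derivative on the standard basis; two
  representing vectors agree because the derivative is unique.\<close>

lemma GDERIV_gradient:
  fixes f :: "real ^ 'd \<Rightarrow> real"
  assumes "f differentiable at x"
  shows "GDERIV f x :> gradient f x"
proof -
  obtain D where D: "(f has_derivative D) (at x)"
    using assms by (auto simp: differentiable_def)
  then interpret bounded_linear D by (rule has_derivative_bounded_linear)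
  have "D = (\<lambda>h. h \<bullet> (\<chi> i. D (axis i 1)))"
  proof
    fix h :: "real ^ 'd"
    have "D h = D (\<Sum>i\<in>UNIV. h $ i *\<^sub>R axis i 1)"
      by (simp add: basis_expansion flip: scalar_mult_eq_scaleR)
    then show "D h = h \<bullet> (\<chi> i. D (axis i 1))"
      by (simp add: sum scaleR inner_vec_def)
  qed
  then have "GDERIV f x :> (\<chi> i. D (axis i 1))"
    using D unfolding gderiv_def by metis
  moreover have "E = E'" if "GDERIV f x :> E" "GDERIV f x :> E'" for E E'
  proof -
    have "(\<lambda>h. h \<bullet> E) = (\<lambda>h. h \<bullet> E')"
      using that unfolding gderiv_def by (rule has_derivative_unique)
    then have "(E - E') \<bullet> E = (E - E') \<bullet> E'" by metis
    then have "(E - E') \<bullet> (E - E') = 0" by (simp add: inner_diff_right)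
    then show "E = E'" by simp
  qed
  ultimately show ?thesis unfolding gradient_def by (metis the_equality)
qed

lemma has_derivative_gradient:
  assumes "gradient f differentiable at x"
  shows "(gradient f has_derivative (\<lambda>v. hessian f x *v v)) (at x)"
  using assms unfolding frechet_derivative_works hessian_def
  by (simp add: has_derivative_linear)

text \<open>Mean value theorem for the scalar function \<open>\<phi>\<close> along the segment from
  y to x: its derivative is the Hessian quadratic form in the direction x - y, which convexity
  bounds below.\<close>

lemma strongly_monotone_gradient:
  fixes f :: "real ^ 'd \<Rightarrow> real"
  assumes diff: "\<And>x. gradient f differentiable at x"
    and convex: "\<And>x v. v \<bullet> ((hessian f x - \<alpha> *\<^sub>R mat 1) *v v) \<ge> 0"
  shows "\<alpha> * (norm (x - y))\<^sup>2 \<le> (gradient f x - gradient f y) \<bullet> (x - y)"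
proof -
  define v where "v = x - y"
  define \<phi> where "\<phi> t = gradient f (y + t *\<^sub>R v) \<bullet> v" for t :: real
  have "(\<phi> has_derivative (\<lambda>s. (hessian f (y + t *\<^sub>R v) *v (s *\<^sub>R v)) \<bullet> v)) (at t)" for t
    unfolding \<phi>_def
    by (rule has_derivative_inner_left has_derivative_compose[OF _ has_derivative_gradient[OF diff]]
          derivative_eq_intros | simp)+
  then have "\<exists>t\<in>{0<..<1}. \<phi> 1 - \<phi> 0 = (hessian f (y + t *\<^sub>R v) *v ((1 - 0) *\<^sub>R v)) \<bullet> v"
    by (intro mvt_simple) (auto intro: has_derivative_at_withinI)
  then obtain t where "\<phi> 1 - \<phi> 0 = (hessian f (y + t *\<^sub>R v) *v v) \<bullet> v" by auto
  moreover have "\<alpha> * (v \<bullet> v) \<le> v \<bullet> (hessian f (y + t *\<^sub>R v) *v v)"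
    using convex[of v "y + t *\<^sub>R v"]
    by (simp add: matrix_vector_mult_diff_rdistrib inner_diff_right scaleR_matrix_vector_assoc[symmetric])
  moreover have "\<phi> 1 - \<phi> 0 = (gradient f x - gradient f y) \<bullet> v"
    by (simp add: \<phi>_def v_def inner_diff_left)
  ultimately show ?thesis
    by (simp add: v_def[symmetric] power2_norm_eq_inner inner_commute)
qed

text \<open>Entries of a bounded Hessian are bounded, which bounds its operator norm by d * d * B;
  the mean value inequality does the rest. The constant is far from sharp, but only its existence
  matters.\<close>

lemma lipschitz_gradient:
  fixes f :: "real ^ 'd \<Rightarrow> real"
  assumes diff: "\<And>x. gradient f differentiable at x"
    and bdd: "bounded (range (hessian f))"
  obtains L where "L > 0" "\<And>x y. norm (gradient f x - gradient f y) \<le> L * norm (x - y)"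
proof -
  obtain B where B: "B > 0" "\<And>x. norm (hessian f x) \<le> B"
    using bdd unfolding bounded_pos by auto
  have "\<bar>hessian f x $ i $ j\<bar> \<le> B" for x i j
    by (meson B(2) component_le_norm_cart Finite_Cartesian_Product.norm_nth_le order_trans)
  then have "onorm ((*v) (hessian f x)) \<le> real CARD('d) * real CARD('d) * B" for x
    by (intro onorm_le_matrix_component)
  then have "norm (gradient f x - gradient f y) \<le> real CARD('d) * real CARD('d) * B * norm (x - y)" for x y
    by (intro differentiable_bound[OF convex_UNIV])
       (auto intro: has_derivative_gradient diff)
  then show thesis using B(1) by (intro that[of "real CARD('d) * real CARD('d) * B"]) auto
qed

text \<open>The mean value theorem from the critical point gives f x = v . grad f(x0 + t v) with 0 <
  t < 1. Monotonicity at the intermediate point, where the displacement is t v, fixes the sign; the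
  Lipschitz bound gives the growth.\<close>

lemma quadratic_bounds_at_critical_point:
  fixes f :: "real ^ 'd \<Rightarrow> real"
  assumes diff: "\<And>x. f differentiable at x"
    and crit: "gradient f x\<^sub>0 = 0" "f x\<^sub>0 = 0"
    and mono: "\<And>x. 0 \<le> gradient f x \<bullet> (x - x\<^sub>0)"
    and lip: "\<And>x. norm (gradient f x) \<le> L * norm (x - x\<^sub>0)" and "L \<ge> 0"
  shows "0 \<le> f x" "f x \<le> L * (norm (x - x\<^sub>0))\<^sup>2"
proof -
  define v where "v = x - x\<^sub>0"
  have "((\<lambda>t. f (x\<^sub>0 + t *\<^sub>R v)) has_derivative (\<lambda>s. (s *\<^sub>R v) \<bullet> gradient f (x\<^sub>0 + t *\<^sub>R v))) (at t)" for t
    by (rule has_derivative_compose[OF _ GDERIV_gradient[OF diff, unfolded gderiv_def]]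
          derivative_eq_intros | simp)+
  then have "\<exists>t\<in>{0<..<1}. f (x\<^sub>0 + 1 *\<^sub>R v) - f (x\<^sub>0 + 0 *\<^sub>R v) = ((1 - 0) *\<^sub>R v) \<bullet> gradient f (x\<^sub>0 + t *\<^sub>R v)"
    by (intro mvt_simple) (auto intro: has_derivative_at_withinI)
  then obtain t where t: "0 < t" "t < 1" "f x = v \<bullet> gradient f (x\<^sub>0 + t *\<^sub>R v)"
    using crit(2) by (auto simp: v_def)
  have "0 \<le> t * (v \<bullet> gradient f (x\<^sub>0 + t *\<^sub>R v))"
    using mono[of "x\<^sub>0 + t *\<^sub>R v"] by (simp add: inner_commute)
  then show "0 \<le> f x" using t by (simp add: zero_le_mult_iff)
  have "f x \<le> norm v * norm (gradient f (x\<^sub>0 + t *\<^sub>R v))"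
    unfolding t(3) by (rule norm_cauchy_schwarz)
  also have "\<dots> \<le> norm v * (L * (t * norm v))"
    using lip[of "x\<^sub>0 + t *\<^sub>R v"] t by (intro mult_left_mono) auto
  also have "\<dots> \<le> norm v * (L * (1 * norm v))"
    using t \<open>L \<ge> 0\<close> by (intro mult_left_mono mult_right_mono) auto
  finally show "f x \<le> L * (norm (x - x\<^sub>0))\<^sup>2" by (simp add: v_def power2_eq_square mult_ac)
qed

section \<open>Pointwise expansion of even powers of a perturbed norm\<close>

text \<open>Comparing x with y, a mixed monomial is dominated by one of the two extreme monomials of
  the same degree. This is what lets the expansion below keep only two remainder terms.\<close>

lemma mixed_powers_le:
  fixes x y :: real
  assumes "0 \<le> x" "0 \<le> y"
  shows "x ^ Suc m * y ^ Suc n \<le> x ^ (Suc m + n) * y + y ^ (Suc m + Suc n)"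
proof (cases "x \<le> y")
  case True
  then have "x ^ Suc m * y ^ Suc n \<le> y ^ Suc m * y ^ Suc n"
    using assms by (intro mult_right_mono power_mono) auto
  moreover have "0 \<le> x ^ (Suc m + n) * y" using assms by simp
  ultimately show ?thesis by (simp only: power_add)
next
  case False
  then have "x ^ Suc m * (y ^ n * y) \<le> x ^ Suc m * (x ^ n * y)"
    using assms by (intro mult_left_mono mult_right_mono power_mono) auto
  moreover have "0 \<le> y ^ (Suc m + Suc n)" using assms by simp
  ultimately show ?thesis by (simp add: power_add mult_ac)
qed

text \<open>Meant for s = |y|^2, t = 2 g (y . m), w = g^2 |m|^2: then s + t + w = |y + g m|^2 and
  the condition on t is Cauchy-Schwarz. The term linear in t is kept exactly because its expectation
  vanishes later; everything of second order goes into the remainder.\<close>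

lemma power_add_le_linear_part:
  "\<exists>C\<ge>0. \<forall>s t w :: real. 0 \<le> s \<longrightarrow> 0 \<le> w \<longrightarrow> t\<^sup>2 \<le> 4 * s * w \<longrightarrow> 0 \<le> s + t + w \<longrightarrow>
     (s + t + w) ^ Suc q \<le> s ^ Suc q + real (Suc q) * s ^ q * t + C * (s ^ q * w + w ^ Suc q)"
proof (induction q)
  case 0
  show ?case by (rule exI[of _ 1]) auto
next
  case (Suc q)
  then obtain C where C: "C \<ge> 0" and IH: "\<And>s t w :: real. 0 \<le> s \<Longrightarrow> 0 \<le> w \<Longrightarrow> t\<^sup>2 \<le> 4 * s * w \<Longrightarrow> 0 \<le> s + t + w \<Longrightarrow>
     (s + t + w) ^ Suc q \<le> s ^ Suc q + real (Suc q) * s ^ q * t + C * (s ^ q * w + w ^ Suc q)"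
    by blast
  define k where "k = real (Suc q)"
  have k: "k \<ge> 0" by (simp add: k_def)
  show ?case
  \<comment> \<open>After multiplication by s + t + w, every leftover product is at most a multiple
    of the new remainder \<open>R\<close>: 1 from s^(q+1) w, 4 k and 2 k from the linear term times
    t and times w, and 8 C from the old remainder.\<close>
  proof (intro exI[of _ "1 + 6 * k + 8 * C"] conjI allI impI)
    show "0 \<le> 1 + 6 * k + 8 * C" using C k by simp
    fix s t w :: real
    assume *: "0 \<le> s" "0 \<le> w" "t\<^sup>2 \<le> 4 * s * w" "0 \<le> s + t + w"
    have "t\<^sup>2 \<le> (s + w)\<^sup>2"
    proof -
      have "0 \<le> (s - w)\<^sup>2" by simp
      then show ?thesis using *(3) by (simp add: power2_eq_square algebra_simps)
    qed
    \<comment> \<open>Only this upper bound on t is needed; it gives s + t + w <= 2 (s + w).\<close>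
    then have t: "t \<le> s + w" by (rule power2_le_imp_le) (use * in linarith)
    define R where "R = s ^ Suc q * w + w ^ Suc (Suc q)"
    have R0: "s ^ Suc q * w \<le> R" "w ^ Suc (Suc q) \<le> R" "0 \<le> R"
      using * by (auto simp: R_def)
    have "s * w ^ Suc q \<le> R"
      using mixed_powers_le[of s w 0 q] * by (simp add: R_def)
    moreover have R1: "s ^ q * w * w \<le> R"
      using mixed_powers_le[of s w "q - 1" 1] * by (cases q) (auto simp: R_def)
    moreover have "s ^ q * w * s \<le> R" using R0 by (simp add: mult_ac)
    moreover have "w ^ Suc q * w \<le> R" using R0 by (simp add: mult_ac)
    ultimately have R2: "(s ^ q * w + w ^ Suc q) * (2 * (s + w)) \<le> 8 * R"
      by (simp add: algebra_simps)
    have R3: "s ^ q * t * t \<le> 4 * R"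
    proof -
      have "s ^ q * (t * t) \<le> s ^ q * (4 * s * w)"
        using * by (intro mult_left_mono) (auto simp: power2_eq_square)
      then show ?thesis using R0 by (simp add: mult_ac)
    qed
    have R4: "s ^ q * t * w \<le> 2 * R"
    proof -
      have "s ^ q * w * t \<le> s ^ q * w * (s + w)"
        using * t by (intro mult_left_mono) auto
      then show ?thesis using R0 R1 by (simp add: algebra_simps)
    qed
    have R5: "(s ^ q * w + w ^ Suc q) * (s + t + w) \<le> 8 * R"
    proof -
      have "(s ^ q * w + w ^ Suc q) * (s + t + w) \<le> (s ^ q * w + w ^ Suc q) * (2 * (s + w))"
        using * t by (intro mult_left_mono) auto
      with R2 show ?thesis by simp
    qed
    have "(s + t + w) ^ Suc (Suc q) = (s + t + w) ^ Suc q * (s + t + w)" by simp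
    also have "\<dots> \<le> (s ^ Suc q + k * s ^ q * t + C * (s ^ q * w + w ^ Suc q)) * (s + t + w)"
      unfolding k_def by (intro mult_right_mono IH *)
    also have "\<dots> = s ^ Suc (Suc q) + (k + 1) * s ^ Suc q * t + s ^ Suc q * w
        + k * (s ^ q * t * t) + k * (s ^ q * t * w) + C * ((s ^ q * w + w ^ Suc q) * (s + t + w))"
      by (simp add: algebra_simps)
    also have "\<dots> \<le> s ^ Suc (Suc q) + (k + 1) * s ^ Suc q * t + R
        + k * (4 * R) + k * (2 * R) + C * (8 * R)"
      by (intro add_mono mult_left_mono R0 R3 R4 R5 k C order_refl)
    also have "\<dots> = s ^ Suc (Suc q) + real (Suc (Suc q)) * s ^ Suc q * t + (1 + 6 * k + 8 * C) * R"
      by (simp add: k_def algebra_simps)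
    finally show "(s + t + w) ^ Suc (Suc q) \<le> s ^ Suc (Suc q) + real (Suc (Suc q)) * s ^ Suc q * t
        + (1 + 6 * k + 8 * C) * (s ^ Suc q * w + w ^ Suc (Suc q))"
      unfolding R_def .
  qed
qed

text \<open>A form of Young's inequality with a non-optimal constant: either z is at most \<epsilon>
  x, or x is at most z / \<epsilon>, and each case yields one of the two terms.\<close>

lemma power_mult_le_weighted:
  fixes x z \<epsilon> :: real
  assumes "0 \<le> x" "0 \<le> z" "0 < \<epsilon>"
  shows "x ^ q * z \<le> \<epsilon> * x ^ Suc q + (1 / \<epsilon>) ^ q * z ^ Suc q"
proof (cases "z \<le> \<epsilon> * x")
  case True
  then have "x ^ q * z \<le> x ^ q * (\<epsilon> * x)" using assms by (intro mult_left_mono) auto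
  moreover have "0 \<le> (1 / \<epsilon>) ^ q * z ^ Suc q" using assms by simp
  ultimately show ?thesis by (simp add: mult_ac)
next
  case False
  then have "x \<le> z / \<epsilon>" using assms by (simp add: field_simps)
  then have "x ^ q * z \<le> (z / \<epsilon>) ^ q * z" using assms by (intro mult_right_mono power_mono) auto
  moreover have "0 \<le> \<epsilon> * x ^ Suc q" using assms by simp
  ultimately show ?thesis by (simp add: power_divide mult_ac)
qed

text \<open>The expansion is made usable for a recursion: the second-order term costs only a small
  multiple of g |y|^(2q+2) plus noise at order g^(q+2). The constant \<open>D\<close> is uniform in
  g, y and m, which requires the upper bound c on the steps.\<close>

lemma norm_power_add_le:
  fixes \<eta> c :: real
  assumes "\<eta> > 0" "c > 0"
  obtains D where "D \<ge> 0"
    "\<And>g (y :: 'a :: real_inner) m. 0 < g \<Longrightarrow> g \<le> c \<Longrightarrow>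
       norm (y + g *\<^sub>R m) ^ (2 * Suc q) \<le> (1 + \<eta> * g) * norm y ^ (2 * Suc q)
         + 2 * real (Suc q) * g * (norm y ^ (2 * q) * (y \<bullet> m)) + D * g ^ (q + 2) * norm m ^ (2 * Suc q)"
proof -
  obtain C where C: "C \<ge> 0" and le: "\<And>s t w :: real. 0 \<le> s \<Longrightarrow> 0 \<le> w \<Longrightarrow> t\<^sup>2 \<le> 4 * s * w \<Longrightarrow> 0 \<le> s + t + w \<Longrightarrow>
     (s + t + w) ^ Suc q \<le> s ^ Suc q + real (Suc q) * s ^ q * t + C * (s ^ q * w + w ^ Suc q)"
    using power_add_le_linear_part[of q] by blast
  \<comment> \<open>The Young weight, chosen so that C * \<epsilon> <= \<eta>; the 1 covers the case
    C = 0.\<close>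
  define \<epsilon> where "\<epsilon> = \<eta> / (C + 1)"
  have \<epsilon>: "\<epsilon> > 0" "C * \<epsilon> \<le> \<eta>" using assms C by (auto simp: \<epsilon>_def field_simps)
  show thesis
  proof
    show "0 \<le> C * ((1 / \<epsilon>) ^ q + c ^ q)" using C \<epsilon> assms by simp
    fix g and y m :: 'a
    assume g: "0 < g" "g \<le> c"
    define s where "s = (norm y)\<^sup>2"
    define r where "r = (norm m)\<^sup>2"
    define t where "t = 2 * g * (y \<bullet> m)"
    define w where "w = g\<^sup>2 * r"
    have [simp]: "0 \<le> s" "0 \<le> r" "0 \<le> w" by (auto simp: s_def r_def w_def)
    have sum: "(norm (y + g *\<^sub>R m))\<^sup>2 = s + t + w"
      unfolding s_def t_def w_def r_def power2_norm_eq_inner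
      by (simp add: inner_add inner_commute power2_eq_square algebra_simps)
    have "(y \<bullet> m)\<^sup>2 \<le> s * r"
      using Cauchy_Schwarz_ineq[of y m] by (simp add: s_def r_def power2_norm_eq_inner)
    then have "4 * g\<^sup>2 * (y \<bullet> m)\<^sup>2 \<le> 4 * g\<^sup>2 * (s * r)" by (intro mult_left_mono) auto
    then have "t\<^sup>2 \<le> 4 * s * w" by (simp add: t_def w_def power_mult_distrib mult_ac)
    moreover have "0 \<le> s + t + w" using sum by (metis zero_le_power2)
    ultimately have "(s + t + w) ^ Suc q
        \<le> s ^ Suc q + real (Suc q) * s ^ q * t + C * (s ^ q * w + w ^ Suc q)"
      by (intro le) auto
    also have "s ^ q * w + w ^ Suc q \<le> g * (\<epsilon> * s ^ Suc q) + ((1 / \<epsilon>) ^ q + c ^ q) * (g ^ (q + 2) * r ^ Suc q)"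
    proof -
      \<comment> \<open>One factor g of w = g^2 r is held back. Young then acts on g r, and
        restoring that factor gives weight g on the first term and g^(q+2) on the second.\<close>
      have "s ^ q * (g * r) \<le> \<epsilon> * s ^ Suc q + (1 / \<epsilon>) ^ q * (g * r) ^ Suc q"
        using \<epsilon> g by (intro power_mult_le_weighted) auto
      then have "g * (s ^ q * (g * r)) \<le> g * (\<epsilon> * s ^ Suc q + (1 / \<epsilon>) ^ q * (g * r) ^ Suc q)"
        using g by (intro mult_left_mono) auto
      \<comment> \<open>Here the order is g^(2q+2); the q surplus factors of g are bounded by
        c.\<close>
      moreover have "w ^ Suc q \<le> c ^ q * (g ^ (q + 2) * r ^ Suc q)"
      proof -
        have "w ^ Suc q = g ^ q * (g ^ (q + 2) * r ^ Suc q)"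
          by (simp add: w_def power_mult_distrib power_mult[symmetric] power_add power2_eq_square mult_ac)
        also have "\<dots> \<le> c ^ q * (g ^ (q + 2) * r ^ Suc q)"
          using g by (intro mult_right_mono power_mono) auto
        finally show ?thesis .
      qed
      ultimately show ?thesis
        by (simp add: w_def power_mult_distrib power2_eq_square algebra_simps)
    qed
    finally have "(s + t + w) ^ Suc q \<le> s ^ Suc q + real (Suc q) * s ^ q * t
      + C * (g * (\<epsilon> * s ^ Suc q) + ((1 / \<epsilon>) ^ q + c ^ q) * (g ^ (q + 2) * r ^ Suc q))"
      using C by (simp add: mult_left_mono)
    moreover have "C * \<epsilon> * (g * s ^ Suc q) \<le> \<eta> * (g * s ^ Suc q)"
      using \<epsilon> g by (intro mult_right_mono) auto
    ultimately have "(s + t + w) ^ Suc q \<le> (1 + \<eta> * g) * s ^ Suc q + real (Suc q) * s ^ q * t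
      + C * ((1 / \<epsilon>) ^ q + c ^ q) * g ^ (q + 2) * r ^ Suc q"
      by (simp add: algebra_simps)
    then show "norm (y + g *\<^sub>R m) ^ (2 * Suc q) \<le> (1 + \<eta> * g) * norm y ^ (2 * Suc q)
         + 2 * real (Suc q) * g * (norm y ^ (2 * q) * (y \<bullet> m)) + C * ((1 / \<epsilon>) ^ q + c ^ q) * g ^ (q + 2) * norm m ^ (2 * Suc q)"
      unfolding power_mult sum unfolding s_def[symmetric] r_def[symmetric] t_def by (simp add: mult_ac)
  qed
qed

section \<open>The deterministic recursion with polynomially decreasing steps\<close>

text \<open>The right-hand side is the chord over [0, 1] of a convex function; the induction uses
  only x * x <= x.\<close>

lemma one_plus_power_le:
  fixes x :: real
  assumes "0 \<le> x" "x \<le> 1"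
  shows "(1 + x) ^ p \<le> 1 + (2 ^ p - 1) * x"
proof (induction p)
  case (Suc p)
  have "(1 + x) ^ Suc p \<le> (1 + (2 ^ p - 1) * x) * (1 + x)"
    using Suc assms by (simp add: mult_left_mono mult.commute)
  also have "\<dots> = 1 + 2 ^ p * x + (2 ^ p - 1) * (x * x)" by (simp add: algebra_simps)
  also have "(2 ^ p - 1) * (x * x) \<le> (2 ^ p - 1) * (x * 1)"
    using assms by (intro mult_left_mono) auto
  finally show ?case by (simp add: algebra_simps)
qed simp

text \<open>Induction on u_n <= C g_n^p. Replacing g_n^p by g_(n+1)^p costs a factor 1 + O(1/n), and
  1/n is negligible against g_(n+1) because \<beta> < 1. So half of the contraction pays for the
  change of step and the other half absorbs the forcing term.\<close>

lemma recursive_bound_powr_steps: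
  fixes u g :: "nat \<Rightarrow> real" and p :: nat
  assumes g: "\<And>n. n \<ge> 1 \<Longrightarrow> g n = c * real n powr (- \<beta>)"
    and c: "c > 0" and \<beta>: "0 < \<beta>" "\<beta> < 1" and a: "a > 0" and D: "D \<ge> 0"
    and rec: "\<forall>\<^sub>F n in sequentially. u (Suc n) \<le> (1 - a * g (Suc n)) * u n + D * g (Suc n) ^ Suc p"
  shows "\<exists>C\<ge>0. \<forall>n\<ge>1. u n \<le> C * g n ^ p"
proof -
  have g_pos: "g n > 0" if "n \<ge> 1" for n using g[OF that] c that by simp
  have "((\<lambda>n. a * (c * real (Suc n) powr (- \<beta>))) \<longlongrightarrow> 0) sequentially"
    using \<beta> by real_asymp
  then have "\<forall>\<^sub>F n in sequentially. a * (c * real (Suc n) powr (- \<beta>)) < 1"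
    by (rule order_tendstoD) simp
  then have ev1: "\<forall>\<^sub>F n in sequentially. a * g (Suc n) < 1" using g by simp
  have ev2: "\<forall>\<^sub>F n in sequentially. (2 ^ p - 1) * (1 / real n) \<le> a / 2 * (c * real (Suc n) powr (- \<beta>))"
  proof -
    have "((\<lambda>n. 1 / real n / (real (Suc n) powr (- \<beta>))) \<longlongrightarrow> 0) sequentially"
      using \<beta> by real_asymp
    then have "((\<lambda>n. (2 ^ p - 1) * (1 / real n / (real (Suc n) powr (- \<beta>)))) \<longlongrightarrow> (2 ^ p - 1) * 0) sequentially"
      by (intro tendsto_intros)
    then have "\<forall>\<^sub>F n in sequentially. (2 ^ p - 1) * (1 / real n / (real (Suc n) powr (- \<beta>))) < a / 2 * c"
      by (rule order_tendstoD) (use a c in simp)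
    then show ?thesis
    proof eventually_elim
      case (elim n)
      have "0 < real (Suc n) powr (- \<beta>)" by simp
      then have "(2 ^ p - 1) * (1 / real n) < a / 2 * c * real (Suc n) powr (- \<beta>)"
        using elim by (simp only: pos_divide_less_eq times_divide_eq_right)
      then show ?case by (simp only: mult.assoc less_imp_le)
    qed
  qed
  obtain N where N: "N \<ge> 1" "\<And>n. n \<ge> N \<Longrightarrow> a * g (Suc n) < 1"
    "\<And>n. n \<ge> N \<Longrightarrow> (2 ^ p - 1) * (1 / real n) \<le> a / 2 * (c * real (Suc n) powr (- \<beta>))"
    "\<And>n. n \<ge> N \<Longrightarrow> u (Suc n) \<le> (1 - a * g (Suc n)) * u n + D * g (Suc n) ^ Suc p"
  proof -
    have "\<forall>\<^sub>F n in sequentially. n \<ge> 1 \<and> a * g (Suc n) < 1 \<and>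
      (2 ^ p - 1) * (1 / real n) \<le> a / 2 * (c * real (Suc n) powr (- \<beta>)) \<and>
      u (Suc n) \<le> (1 - a * g (Suc n)) * u n + D * g (Suc n) ^ Suc p"
      by (intro eventually_conj ev1 ev2 rec eventually_ge_at_top)
    then show thesis unfolding eventually_sequentially using that by blast
  qed
  have ratio: "g n ^ p \<le> (1 + a / 2 * g (Suc n)) * g (Suc n) ^ p" if "n \<ge> N" for n
  proof -
    have n: "n \<ge> 1" using that N by simp
    have "g n = (1 + 1 / real n) powr \<beta> * g (Suc n)"
    proof -
      have "1 + 1 / real n = real (Suc n) / real n" using n by (simp add: field_simps)
      then show ?thesis using n g[OF n] g[of "Suc n"] by (simp add: powr_divide powr_minus field_simps)
    qed
    \<comment> \<open>Raising the exponent \<beta> to 1 leaves a natural power p of 1 + 1/n, to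
      which \<open>one_plus_power_le\<close> applies.\<close>
    also have "\<dots> \<le> (1 + 1 / real n) powr 1 * g (Suc n)"
      using \<beta> g_pos[of "Suc n"] by (intro mult_right_mono powr_mono) auto
    finally have "g n ^ p \<le> ((1 + 1 / real n) * g (Suc n)) ^ p"
      using g_pos[OF n] by (intro power_mono) auto
    also have "\<dots> = (1 + 1 / real n) ^ p * g (Suc n) ^ p" by (simp add: power_mult_distrib)
    also have "\<dots> \<le> (1 + a / 2 * g (Suc n)) * g (Suc n) ^ p"
    proof (rule mult_right_mono)
      have "(1 + 1 / real n) ^ p \<le> 1 + (2 ^ p - 1) * (1 / real n)"
        using n by (intro one_plus_power_le) auto
      also have "(2 ^ p - 1) * (1 / real n) \<le> a / 2 * g (Suc n)"
        using N(3)[OF that] g[of "Suc n"] by (metis le_add1 plus_1_eq_Suc)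
      finally show "(1 + 1 / real n) ^ p \<le> 1 + a / 2 * g (Suc n)" by simp
    qed (use g_pos[of "Suc n"] in simp)
    finally show ?thesis .
  qed
  \<comment> \<open>The entry 2 D / a absorbs the forcing term in the induction; the ratios up to N
    settle the indices where the recursion may fail and start the induction.\<close>
  define C where "C = Max (insert (2 * D / a) ((\<lambda>n. u n / g n ^ p) ` {1..N}))"
  have C: "2 * D / a \<le> C" "\<And>n. n \<in> {1..N} \<Longrightarrow> u n / g n ^ p \<le> C"
    unfolding C_def by (rule Max_ge; force)+
  have C0: "C \<ge> 0" using C(1) D a by (meson divide_nonneg_pos mult_nonneg_nonneg order_trans zero_le_numeral)
  have small: "u n \<le> C * g n ^ p" if "n \<in> {1..N}" for n
    using C(2)[OF that] g_pos[of n] that by (simp add: field_simps)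
  have large: "u n \<le> C * g n ^ p" if "n \<ge> N" for n
    using that
  proof (induction n rule: dec_induct)
    case base
    then show ?case using small N by simp
  next
    case (step n)
    define h where "h = g (Suc n)"
    have h: "h > 0" using g_pos h_def by simp
    have "u (Suc n) \<le> (1 - a * h) * u n + D * h ^ Suc p" using N(4) step h_def by simp
    also have "(1 - a * h) * u n \<le> (1 - a * h) * (C * ((1 + a / 2 * h) * h ^ p))"
      using N(2)[of n] step C0 ratio[of n] unfolding h_def
      by (intro mult_left_mono order_trans[OF step.IH]) auto
    also have "\<dots> = C * ((1 - a * h) * (1 + a / 2 * h)) * h ^ p" by simp
    \<comment> \<open>The product equals 1 - a h / 2 - (a h)^2 / 2.\<close>
    also have "\<dots> \<le> C * (1 - a / 2 * h) * h ^ p"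
      using C0 h a by (intro mult_right_mono mult_left_mono) (auto simp: algebra_simps)
    also have "D * h ^ Suc p \<le> C * (a / 2 * h) * h ^ p"
    proof -
      have "D \<le> C * (a / 2)" using C(1) a by (simp add: field_simps)
      then have "D * h ^ Suc p \<le> C * (a / 2) * h ^ Suc p" using h by (intro mult_right_mono) auto
      then show ?thesis by (simp add: mult_ac)
    qed
    also have "C * (1 - a / 2 * h) * h ^ p + C * (a / 2 * h) * h ^ p = C * h ^ p"
      by (simp add: algebra_simps)
    finally show ?case by (simp add: h_def)
  qed
  show ?thesis
  proof (intro exI[of _ C] conjI allI impI C0)
    fix n :: nat assume "n \<ge> 1"
    then show "u n \<le> C * g n ^ p" using small large by (cases "n \<le> N") auto
  qed
qed

section \<open>Measurability, independence and conditioning for the iterates\<close>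

text \<open>The underlying space N is left free: it is used both for the probability space and for
  the product space of the first n noise values.\<close>

lemma measurable_sgd:
  assumes "\<Lambda> \<in> measurable (borel \<Otimes>\<^sub>M borel) borel"
    and "\<And>i. i \<in> {1..n} \<Longrightarrow> Z i \<in> measurable N borel"
  shows "sgd \<Lambda> \<gamma> Z \<theta>\<^sub>0 n \<in> measurable N borel"
  using assms(2)
proof (induction n)
  case (Suc n)
  have [measurable]: "Z (Suc n) \<in> measurable N borel" "sgd \<Lambda> \<gamma> Z \<theta>\<^sub>0 n \<in> measurable N borel"
    using Suc by auto
  note assms(1)[measurable]
  show ?case unfolding sgd.simps by measurable
qed simp

text \<open>Writes the iterate as a fixed function of the noise block, with coordinate projections
  in place of \<open>Z\<close>, so that independence of blocks transfers to the iterates. Keeping m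
  apart from n lets the induction use one and the same block.\<close>

lemma sgd_restrict:
  assumes "n \<le> m"
  shows "sgd \<Lambda> \<gamma> Z \<theta>\<^sub>0 n \<omega> = sgd \<Lambda> \<gamma> (\<lambda>i w. w i) \<theta>\<^sub>0 n (\<lambda>i\<in>{1..m}. Z i \<omega>)"
  using assms by (induction n) auto

text \<open>The joint law is a product, so Fubini integrates over Y first with x frozen, and that
  inner integral is zero. This replaces an argument by conditional expectation.\<close>

lemma (in prob_space) expectation_indep_var_eq_0:
  fixes h :: "'b \<Rightarrow> 'b \<Rightarrow> real"
  assumes indep: "indep_var S X T Y"
    and h [measurable]: "case_prod h \<in> borel_measurable (S \<Otimes>\<^sub>M T)"
    and int: "integrable M (\<lambda>\<omega>. h (X \<omega>) (Y \<omega>))"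
    and zero: "\<And>x. x \<in> space S \<Longrightarrow> expectation (\<lambda>\<omega>. h x (Y \<omega>)) = 0"
  shows "expectation (\<lambda>\<omega>. h (X \<omega>) (Y \<omega>)) = 0"
proof -
  have [measurable]: "X \<in> measurable M S" "Y \<in> measurable M T"
    and eq: "distr M S X \<Otimes>\<^sub>M distr M T Y = distr M (S \<Otimes>\<^sub>M T) (\<lambda>\<omega>. (X \<omega>, Y \<omega>))"
    using indep unfolding indep_var_distribution_eq by auto
  interpret X: prob_space "distr M S X" by (rule prob_space_distr) simp
  interpret Y: prob_space "distr M T Y" by (rule prob_space_distr) simp
  interpret XY: pair_sigma_finite "distr M S X" "distr M T Y" ..
  have "integrable (distr M S X \<Otimes>\<^sub>M distr M T Y) (case_prod h)"
    unfolding eq using int by (subst integrable_distr_eq) auto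
  then have "(\<integral>x. (\<integral>y. h x y \<partial>distr M T Y) \<partial>distr M S X)
      = integral\<^sup>L (distr M S X \<Otimes>\<^sub>M distr M T Y) (case_prod h)"
    using XY.integral_fst'[of "case_prod h"] by simp
  also have "\<dots> = expectation (\<lambda>\<omega>. h (X \<omega>) (Y \<omega>))"
    unfolding eq by (subst integral_distr) auto
  also have "(\<integral>x. (\<integral>y. h x y \<partial>distr M T Y) \<partial>distr M S X) = (\<integral>x. 0 \<partial>distr M S X)"
  proof (rule Bochner_Integration.integral_cong)
    fix x assume "x \<in> space (distr M S X)"
    then have x: "x \<in> space S" by simp
    then have "(\<lambda>y. h x y) \<in> borel_measurable T" by measurable
    then show "(\<integral>y. h x y \<partial>distr M T Y) = 0"
      using zero[OF x] by (subst integral_distr) auto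
  qed simp
  finally show ?thesis by simp
qed

lemma (in prob_space) expectation_sgd_eq_0:
  fixes Z :: "nat \<Rightarrow> 'a \<Rightarrow> real ^ 'k" and h :: "real ^ 'd \<Rightarrow> real ^ 'k \<Rightarrow> real"
  assumes \<Lambda>: "\<Lambda> \<in> measurable (borel \<Otimes>\<^sub>M borel) borel"
    and Z: "indep_vars (\<lambda>_. borel) Z {1..}"
    and h [measurable]: "case_prod h \<in> borel_measurable (borel \<Otimes>\<^sub>M borel)"
    and int: "integrable M (\<lambda>\<omega>. h (sgd \<Lambda> \<gamma> Z \<theta>\<^sub>0 n \<omega>) (Z (Suc n) \<omega>))"
    and zero: "\<And>x. expectation (\<lambda>\<omega>. h x (Z (Suc n) \<omega>)) = 0"
  shows "expectation (\<lambda>\<omega>. h (sgd \<Lambda> \<gamma> Z \<theta>\<^sub>0 n \<omega>) (Z (Suc n) \<omega>)) = 0"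
proof -
  define S where "S = PiM {1..n} (\<lambda>_. borel :: (real ^ 'k) measure)"
  \<comment> \<open>The single variable \<open>Z (Suc n)\<close> is treated as a one-element block,
    disjoint from {1..n}, so that independence of disjoint blocks applies; for n = 0 the first block
    is empty.\<close>
  define T where "T = PiM {Suc n} (\<lambda>_. borel :: (real ^ 'k) measure)"
  let ?s = "sgd \<Lambda> \<gamma> (\<lambda>i w. w i) \<theta>\<^sub>0 n :: (nat \<Rightarrow> real ^ 'k) \<Rightarrow> real ^ 'd"
  have indep: "indep_var S (\<lambda>\<omega>. \<lambda>i\<in>{1..n}. Z i \<omega>) T (\<lambda>\<omega>. \<lambda>i\<in>{Suc n}. Z i \<omega>)"
    unfolding S_def T_def by (intro indep_var_restrict[OF Z]) auto
  have [measurable]: "?s \<in> measurable S borel"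
    unfolding S_def by (intro measurable_sgd[OF \<Lambda>]) auto
  have [measurable]: "(\<lambda>w. w (Suc n)) \<in> measurable T borel"
    unfolding T_def by simp
  have "expectation (\<lambda>\<omega>. h (?s (\<lambda>i\<in>{1..n}. Z i \<omega>)) ((\<lambda>i\<in>{Suc n}. Z i \<omega>) (Suc n))) = 0"
  proof (rule expectation_indep_var_eq_0[OF indep])
    show "(\<lambda>(v, w). h (?s v) (w (Suc n))) \<in> borel_measurable (S \<Otimes>\<^sub>M T)"
      by measurable
    show "integrable M (\<lambda>\<omega>. h (?s (\<lambda>i\<in>{1..n}. Z i \<omega>)) ((\<lambda>i\<in>{Suc n}. Z i \<omega>) (Suc n)))"
      using int unfolding sgd_restrict[OF order_refl, symmetric] by simp
  qed (simp add: zero)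
  then show ?thesis
    unfolding sgd_restrict[OF order_refl, symmetric] by simp
qed

text \<open>Tower property: the defining identity of \<open>nn_cond_exp\<close> tested against the
  constant 1. The conditional noise bound enters the proof only through this integrated
  form.\<close>

lemma (in prob_space) nn_integral_le_of_nn_cond_exp_le:
  assumes "subalgebra M F" and [measurable]: "g \<in> borel_measurable M"
    and "AE \<omega> in M. nn_cond_exp M F g \<omega> \<le> h \<omega>"
  shows "(\<integral>\<^sup>+\<omega>. g \<omega> \<partial>M) \<le> (\<integral>\<^sup>+\<omega>. h \<omega> \<partial>M)"
proof -
  interpret F: finite_measure_subalgebra M F by standard fact
  have "(\<integral>\<^sup>+\<omega>. g \<omega> \<partial>M) = (\<integral>\<^sup>+\<omega>. nn_cond_exp M F g \<omega> \<partial>M)"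
    using F.nn_cond_exp_intg[of "\<lambda>_. 1" g] by simp
  also have "\<dots> \<le> (\<integral>\<^sup>+\<omega>. h \<omega> \<partial>M)" by (rule nn_integral_mono_AE) fact
  finally show ?thesis .
qed

lemma subalgebra_gen_filtration:
  assumes "\<And>i. i \<in> {1..n} \<Longrightarrow> X i \<in> borel_measurable M"
  shows "subalgebra M (gen_filtration M X n)"
proof -
  have *: "(\<Union>i\<in>{1..n}. {X i -` A \<inter> space M | A. A \<in> sets borel}) \<subseteq> sets M"
    using assms by (auto intro: measurable_sets)
  then have "(\<Union>i\<in>{1..n}. {X i -` A \<inter> space M | A. A \<in> sets borel}) \<subseteq> Pow (space M)"
    using sets.space_closed by blast
  with * show ?thesis
    unfolding subalgebra_def gen_filtration_def
    by (simp add: space_measure_of sets_measure_of sets.sigma_sets_subset)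
qed

section \<open>Bounds for a single step and its moments\<close>

text \<open>Supplies an integrable majorant for the cross term: Cauchy-Schwarz, then Young with
  weight 1.\<close>

lemma norm_power_mult_inner_le:
  fixes x y :: "'a :: real_inner"
  shows "norm x ^ (2 * q) * \<bar>x \<bullet> y\<bar> \<le> norm x ^ (2 * Suc q) + norm y ^ (2 * Suc q)"
proof -
  have "norm x ^ (2 * q) * \<bar>x \<bullet> y\<bar> \<le> norm x ^ (2 * q) * (norm x * norm y)"
    by (intro mult_left_mono Cauchy_Schwarz_ineq2) simp
  also have "\<dots> = norm x ^ (2 * q + 1) * norm y" by simp
  also have "\<dots> \<le> norm x ^ (2 * Suc q) + norm y ^ (2 * Suc q)"
    using power_mult_le_weighted[of "norm x" "norm y" 1 "2 * q + 1"] by simp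
  finally show ?thesis .
qed

text \<open>Turns a bound in (1 + f)^p into one affine in |x - \<theta>*|^(2p), via 1 + L x <= (1 +
  L) max 1 x.\<close>

lemma one_plus_mult_power_le:
  fixes x L :: real
  assumes "0 \<le> x" "0 \<le> L"
  shows "(1 + L * x) ^ p \<le> (1 + L) ^ p * (1 + x ^ p)"
proof -
  have "1 + L * x \<le> (1 + L) * max 1 x"
  proof (cases "x \<le> 1")
    case True
    then show ?thesis using assms by (simp add: mult_left_le)
  next
    case False
    then show ?thesis by (simp add: algebra_simps)
  qed
  then have "(1 + L * x) ^ p \<le> ((1 + L) * max 1 x) ^ p"
    using assms by (intro power_mono) auto
  also have "\<dots> = (1 + L) ^ p * max 1 x ^ p" by (rule power_mult_distrib)
  also have "\<dots> \<le> (1 + L) ^ p * (1 + x ^ p)"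
    using assms by (intro mult_left_mono) (auto simp: max_def)
  finally show ?thesis .
qed

text \<open>The first bound holds for every positive step and serves integrability. The second
  expands the square to get the factor 1 - 2 \<alpha> g + g^2 L^2, where a small step lets half of
  the linear gain absorb the quadratic loss.\<close>

lemma gradient_step_bounds:
  fixes x \<theta> G :: "'a :: real_inner"
  assumes "0 < g" "0 \<le> L"
    and lip: "norm G \<le> L * norm (x - \<theta>)" and mono: "\<alpha> * (norm (x - \<theta>))\<^sup>2 \<le> G \<bullet> (x - \<theta>)"
  shows "norm (x - \<theta> - g *\<^sub>R G) \<le> (1 + g * L) * norm (x - \<theta>)"
    and "g * L\<^sup>2 \<le> \<alpha> \<Longrightarrow> \<alpha> * g \<le> 1 \<Longrightarrow> 0 \<le> \<alpha> \<Longrightarrow>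
      norm (x - \<theta> - g *\<^sub>R G) ^ (2 * Suc q) \<le> (1 - \<alpha> * g) * norm (x - \<theta>) ^ (2 * Suc q)"
proof -
  define v where "v = x - \<theta>"
  have "norm (v - g *\<^sub>R G) \<le> norm v + g * norm G"
    using norm_triangle_ineq4[of v "g *\<^sub>R G"] assms(1) by simp
  also have "\<dots> \<le> norm v + g * (L * norm v)"
    using lip assms(1) by (simp add: v_def)
  finally show "norm (x - \<theta> - g *\<^sub>R G) \<le> (1 + g * L) * norm (x - \<theta>)"
    by (simp add: v_def algebra_simps)
  assume g: "g * L\<^sup>2 \<le> \<alpha>" "\<alpha> * g \<le> 1" "0 \<le> \<alpha>"
  have "(norm (v - g *\<^sub>R G))\<^sup>2 = (norm v)\<^sup>2 - 2 * g * (G \<bullet> v) + g\<^sup>2 * (norm G)\<^sup>2"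
    unfolding power2_norm_eq_inner
    by (simp add: inner_diff inner_commute power2_eq_square algebra_simps)
  also have "\<dots> \<le> (norm v)\<^sup>2 - 2 * g * (\<alpha> * (norm v)\<^sup>2) + g\<^sup>2 * (L * norm v)\<^sup>2"
    using assms by (intro add_mono diff_mono mult_left_mono power_mono) (auto simp: v_def)
  also have "g\<^sup>2 * (L * norm v)\<^sup>2 = g * (g * L\<^sup>2) * (norm v)\<^sup>2"
    by (simp add: power2_eq_square)
  also have "\<dots> \<le> g * \<alpha> * (norm v)\<^sup>2"
    using g assms(1) by (intro mult_right_mono mult_left_mono) auto
  finally have *: "(norm (v - g *\<^sub>R G))\<^sup>2 \<le> (1 - \<alpha> * g) * (norm v)\<^sup>2"
    by (simp add: algebra_simps)
  have "norm (v - g *\<^sub>R G) ^ (2 * Suc q) \<le> ((1 - \<alpha> * g) * (norm v)\<^sup>2) ^ Suc q"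
    unfolding power_mult using * by (intro power_mono) auto
  also have "\<dots> = (1 - \<alpha> * g) ^ Suc q * norm v ^ (2 * Suc q)"
    unfolding power_mult by (rule power_mult_distrib)
  \<comment> \<open>The factor lies in [0, 1], so its higher powers are no larger than
    itself.\<close>
  also have "\<dots> \<le> (1 - \<alpha> * g) ^ 1 * norm v ^ (2 * Suc q)"
    using g assms(1) by (intro mult_right_mono power_decreasing) auto
  finally show "norm (x - \<theta> - g *\<^sub>R G) ^ (2 * Suc q) \<le> (1 - \<alpha> * g) * norm (x - \<theta>) ^ (2 * Suc q)"
    by (simp add: v_def)
qed

lemma integrable_norm_power_mult_inner:
  fixes y m :: "'a \<Rightarrow> 'b :: euclidean_space"
  assumes [measurable]: "y \<in> borel_measurable M" "m \<in> borel_measurable M"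
    and int: "integrable M (\<lambda>\<omega>. norm (y \<omega>) ^ (2 * Suc q))" "integrable M (\<lambda>\<omega>. norm (m \<omega>) ^ (2 * Suc q))"
  shows "integrable M (\<lambda>\<omega>. norm (y \<omega>) ^ (2 * q) * (y \<omega> \<bullet> m \<omega>))"
proof (rule Bochner_Integration.integrable_bound)
  show "integrable M (\<lambda>\<omega>. norm (y \<omega>) ^ (2 * Suc q) + norm (m \<omega>) ^ (2 * Suc q))"
    using int by (rule Bochner_Integration.integrable_add)
  show "AE \<omega> in M. norm (norm (y \<omega>) ^ (2 * q) * (y \<omega> \<bullet> m \<omega>))
      \<le> norm (norm (y \<omega>) ^ (2 * Suc q) + norm (m \<omega>) ^ (2 * Suc q))"
    using norm_power_mult_inner_le[of "y _" q "m _"]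
    by (intro AE_I2) (simp add: abs_mult del: mult_Suc_right power_Suc)
qed measurable

text \<open>Integrating the pointwise expansion: the centred cross term removes \<open>b\<close>,
  and the same majorant \<open>R\<close> yields integrability of the next iterate.\<close>

lemma (in prob_space) moment_of_perturbed_step:
  fixes y m :: "'a \<Rightarrow> 'b :: euclidean_space"
  assumes [measurable]: "y \<in> borel_measurable M" "m \<in> borel_measurable M"
    and int: "integrable M (\<lambda>\<omega>. norm (y \<omega>) ^ (2 * Suc q))" "integrable M (\<lambda>\<omega>. norm (m \<omega>) ^ (2 * Suc q))"
    and centered: "expectation (\<lambda>\<omega>. norm (y \<omega>) ^ (2 * q) * (y \<omega> \<bullet> m \<omega>)) = 0"
    and bound: "\<And>u v :: 'b. norm (u + g *\<^sub>R v) ^ (2 * Suc q) \<le> a * norm u ^ (2 * Suc q)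
         + b * (norm u ^ (2 * q) * (u \<bullet> v)) + d * norm v ^ (2 * Suc q)"
  shows "integrable M (\<lambda>\<omega>. norm (y \<omega> + g *\<^sub>R m \<omega>) ^ (2 * Suc q))"
    and "expectation (\<lambda>\<omega>. norm (y \<omega> + g *\<^sub>R m \<omega>) ^ (2 * Suc q))
      \<le> a * expectation (\<lambda>\<omega>. norm (y \<omega>) ^ (2 * Suc q)) + d * expectation (\<lambda>\<omega>. norm (m \<omega>) ^ (2 * Suc q))"
proof -
  have cross: "integrable M (\<lambda>\<omega>. norm (y \<omega>) ^ (2 * q) * (y \<omega> \<bullet> m \<omega>))"
    using assms(1,2) int by (rule integrable_norm_power_mult_inner)
  define R where "R \<omega> = a * norm (y \<omega>) ^ (2 * Suc q)
    + b * (norm (y \<omega>) ^ (2 * q) * (y \<omega> \<bullet> m \<omega>)) + d * norm (m \<omega>) ^ (2 * Suc q)" for \<omega>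
  have R: "integrable M R" "expectation R
      = a * expectation (\<lambda>\<omega>. norm (y \<omega>) ^ (2 * Suc q)) + d * expectation (\<lambda>\<omega>. norm (m \<omega>) ^ (2 * Suc q))"
    unfolding R_def using int cross centered by (simp_all del: mult_Suc_right power_Suc)
  have le: "norm (y \<omega> + g *\<^sub>R m \<omega>) ^ (2 * Suc q) \<le> R \<omega>" for \<omega>
    unfolding R_def by (rule bound)
  show *: "integrable M (\<lambda>\<omega>. norm (y \<omega> + g *\<^sub>R m \<omega>) ^ (2 * Suc q))"
  proof (rule Bochner_Integration.integrable_bound[OF R(1)])
    show "AE \<omega> in M. norm (norm (y \<omega> + g *\<^sub>R m \<omega>) ^ (2 * Suc q)) \<le> norm (R \<omega>)"
    proof (rule AE_I2)
      fix \<omega>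
      have "norm (norm (y \<omega> + g *\<^sub>R m \<omega>) ^ (2 * Suc q)) = norm (y \<omega> + g *\<^sub>R m \<omega>) ^ (2 * Suc q)"
        unfolding real_norm_def by (rule abs_of_nonneg) simp
      also have "\<dots> \<le> norm (R \<omega>)" using le[of \<omega>] by (simp del: mult_Suc_right power_Suc)
      finally show "norm (norm (y \<omega> + g *\<^sub>R m \<omega>) ^ (2 * Suc q)) \<le> norm (R \<omega>)" .
    qed
  qed measurable
  show "expectation (\<lambda>\<omega>. norm (y \<omega> + g *\<^sub>R m \<omega>) ^ (2 * Suc q))
      \<le> a * expectation (\<lambda>\<omega>. norm (y \<omega>) ^ (2 * Suc q)) + d * expectation (\<lambda>\<omega>. norm (m \<omega>) ^ (2 * Suc q))"
    unfolding R(2)[symmetric] by (rule integral_mono[OF * R(1) le])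
qed

section \<open>From the one-step estimate to the rate for the stochastic gradient iterates\<close>

theorem proposition1p1:
  fixes f :: "real ^ 'd \<Rightarrow> real"
    and \<theta>star \<theta>\<^sub>0 :: "real ^ 'd"
    and M :: "'w measure"
    and \<Lambda> :: "(real ^ 'd) \<times> (real ^ 'k) \<Rightarrow> real ^ 'd"
    and Z :: "nat \<Rightarrow> 'w \<Rightarrow> real ^ 'k"
    and \<gamma> :: "nat \<Rightarrow> real"
    and c \<beta> \<alpha> :: real
    and p :: nat
    and \<theta> :: "nat \<Rightarrow> 'w \<Rightarrow> real ^ 'd"
  assumes \<theta>: "\<theta> = sgd \<Lambda> \<gamma> Z \<theta>\<^sub>0"
    and f_C2: "class_C2 f"
    and f_coercive: "filterlim f at_top at_infinity"
    and f_crit: "{x. gradient f x = 0} = {\<theta>star}"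
    and f_min: "f \<theta>star = 0"
    and M: "prob_space M"
    and \<Lambda>_meas: "\<Lambda> \<in> measurable (borel \<Otimes>\<^sub>M borel) borel"
    and Z_indep: "prob_space.indep_vars M (\<lambda>_. borel) Z {1..}"
    and Z_ident: "\<And>n. n \<ge> 1 \<Longrightarrow> distr M borel (Z n) = distr M borel (Z 1)"
    and \<Lambda>_mean: "\<And>t. has_bochner_integral M (\<lambda>\<omega>. \<Lambda> (t, Z 1 \<omega>)) (gradient f t)"
    and c_pos: "c > 0"
    and \<beta>: "\<beta> \<in> {0<..<1}"
    and \<gamma>: "\<And>n. n \<ge> 1 \<Longrightarrow> \<gamma> n = c * real n powr (- \<beta>)"
    and p: "p \<ge> 1"
    and \<alpha>_pos: "\<alpha> > 0"
    and f_strongly_convex: "\<And>x v. v \<bullet> ((hessian f x - \<alpha> *\<^sub>R mat 1) *v v) \<ge> 0"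
    and hess_bounded: "bounded (range (hessian f))"
    and hess_lipschitz: "\<exists>L. L-lipschitz_on UNIV (hessian f)"
    and noise: "\<exists>\<Sigma>\<^sub>p :: real. \<forall>n. AE \<omega> in M.
      nn_cond_exp M (gen_filtration M \<theta> n)
          (\<lambda>\<omega>'. ennreal (norm (sgd_noise f \<Lambda> Z \<theta> (n + 1) \<omega>') ^ (2 * p))) \<omega>
        \<le> ennreal (\<Sigma>\<^sub>p * (1 + f (\<theta> n \<omega>)) ^ p)"
  shows "\<exists>C\<^sub>p :: real. \<forall>n\<ge>1.
    integrable M (\<lambda>\<omega>. norm (\<theta> n \<omega> - \<theta>star) ^ p) \<and>
    (\<integral>\<omega>. norm (\<theta> n \<omega> - \<theta>star) ^ p \<partial>M) \<le> C\<^sub>p * \<gamma> n powr (real p / 2)"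
proof -
  interpret prob_space M by (rule M)
  obtain q where q: "p = Suc q" using p by (cases p) auto
  have diff: "f differentiable at x" and diff': "gradient f differentiable at x" for x
    using f_C2 by (auto simp: class_C2_def)
  have crit: "gradient f \<theta>star = 0" using f_crit by blast
  obtain L where L: "L > 0" and lip': "\<And>x y. norm (gradient f x - gradient f y) \<le> L * norm (x - y)"
    using lipschitz_gradient[OF diff' hess_bounded] by blast
  have mono: "\<alpha> * (norm (x - \<theta>star))\<^sup>2 \<le> gradient f x \<bullet> (x - \<theta>star)" for x
    using strongly_monotone_gradient[OF diff' f_strongly_convex, of x \<theta>star] crit by simp
  have lip: "norm (gradient f x) \<le> L * norm (x - \<theta>star)" for x
    using lip'[of x \<theta>star] crit by simp
  have mono0: "0 \<le> gradient f x \<bullet> (x - \<theta>star)" for x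
    using mono[of x] \<alpha>_pos by (meson mult_nonneg_nonneg less_imp_le order_trans zero_le_power2)
  have f_bounds: "0 \<le> f x" "f x \<le> L * (norm (x - \<theta>star))\<^sup>2" for x
    using quadratic_bounds_at_critical_point[OF diff crit f_min mono0 lip] L by auto

  have grad_meas [measurable]: "gradient f \<in> borel_measurable borel"
    by (intro borel_measurable_continuous_onI)
       (auto intro: continuous_at_imp_continuous_on differentiable_imp_continuous_within diff')
  have Z_meas [measurable]: "Z n \<in> borel_measurable M" if "n \<ge> 1" for n
    using Z_indep that by (auto simp: indep_vars_def)
  note \<Lambda>_meas[measurable]
  have \<theta>_meas [measurable]: "\<theta> n \<in> borel_measurable M" for n
    unfolding \<theta> by (intro measurable_sgd \<Lambda>_meas Z_meas) auto

  \<comment> \<open>Index shift: \<open>\<Delta> n\<close> is the noise driving the passage from n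
    to n + 1.\<close>
  define \<Delta> where "\<Delta> n \<omega> = sgd_noise f \<Lambda> Z \<theta> (n + 1) \<omega>" for n \<omega>
  have \<Delta>: "\<Delta> n \<omega> = gradient f (\<theta> n \<omega>) - \<Lambda> (\<theta> n \<omega>, Z (Suc n) \<omega>)" for n \<omega>
    by (simp add: \<Delta>_def sgd_noise_def)
  have \<Delta>_meas [measurable]: "\<Delta> n \<in> borel_measurable M" for n
    using Z_meas[of "Suc n"] unfolding \<Delta> by measurable
  define Y where "Y n x = x - \<theta>star - \<gamma> (Suc n) *\<^sub>R gradient f x" for n x
  have Y_meas [measurable]: "Y n \<in> borel_measurable borel" for n
    unfolding Y_def by measurable
  have step: "\<theta> (Suc n) \<omega> - \<theta>star = Y n (\<theta> n \<omega>) + \<gamma> (Suc n) *\<^sub>R \<Delta> n \<omega>" for n \<omega>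
    unfolding Y_def \<Delta> by (simp add: \<theta> algebra_simps)

  have \<gamma>_pos: "0 < \<gamma> n" and \<gamma>_le: "\<gamma> n \<le> c" if "n \<ge> 1" for n
  proof -
    show "0 < \<gamma> n" using \<gamma>[OF that] c_pos that by simp
    have "real n powr (- \<beta>) \<le> real n powr 0" using \<beta> that by (intro powr_mono) auto
    then show "\<gamma> n \<le> c" using \<gamma>[OF that] c_pos that by (simp add: mult_left_le)
  qed

  define u where "u n = expectation (\<lambda>\<omega>. norm (\<theta> n \<omega> - \<theta>star) ^ (2 * Suc q))" for n
  have u_nonneg: "0 \<le> u n" for n unfolding u_def by (rule Bochner_Integration.integral_nonneg) simp

  obtain \<Sigma> where \<Sigma>: "\<And>n. AE \<omega> in M. nn_cond_exp M (gen_filtration M \<theta> n)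
      (\<lambda>\<omega>'. ennreal (norm (\<Delta> n \<omega>') ^ (2 * p))) \<omega> \<le> ennreal (\<Sigma> * (1 + f (\<theta> n \<omega>)) ^ p)"
    using noise unfolding \<Delta>_def by blast
  \<comment> \<open>The absolute value is taken because the sign of \<open>\<Sigma>\<close> is not
    prescribed; (1 + L)^p comes from the quadratic growth of f.\<close>
  define S where "S = \<bar>\<Sigma>\<bar> * (1 + L) ^ Suc q"
  have S: "0 \<le> S" using L by (simp add: S_def)
  \<comment> \<open>This and the next moment facts assume integrability at index n only; together
    they give it at n + 1, and the induction is closed at \<open>int\<close>.\<close>
  have noise_moment: "integrable M (\<lambda>\<omega>. norm (\<Delta> n \<omega>) ^ (2 * Suc q))"
      "expectation (\<lambda>\<omega>. norm (\<Delta> n \<omega>) ^ (2 * Suc q)) \<le> S * (1 + u n)"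
    if int: "integrable M (\<lambda>\<omega>. norm (\<theta> n \<omega> - \<theta>star) ^ (2 * Suc q))" for n
  proof -
    have le: "\<Sigma> * (1 + f x) ^ p \<le> S * (1 + norm (x - \<theta>star) ^ (2 * Suc q))" for x
    proof -
      have "\<Sigma> * (1 + f x) ^ p \<le> \<bar>\<Sigma>\<bar> * (1 + L * (norm (x - \<theta>star))\<^sup>2) ^ p"
        using f_bounds[of x] by (intro mult_mono power_mono) auto
      also have "\<dots> \<le> \<bar>\<Sigma>\<bar> * ((1 + L) ^ p * (1 + ((norm (x - \<theta>star))\<^sup>2) ^ p))"
        using L by (intro mult_left_mono one_plus_mult_power_le) auto
      finally show ?thesis unfolding S_def q power_mult by (simp only: mult.assoc)
    qed
    have "(\<integral>\<^sup>+\<omega>. ennreal (norm (\<Delta> n \<omega>) ^ (2 * p)) \<partial>M) \<le> (\<integral>\<^sup>+\<omega>. ennreal (\<Sigma> * (1 + f (\<theta> n \<omega>)) ^ p) \<partial>M)"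
      by (rule nn_integral_le_of_nn_cond_exp_le[OF subalgebra_gen_filtration _ \<Sigma>]) measurable
    also have "\<dots> \<le> (\<integral>\<^sup>+\<omega>. ennreal (S * (1 + norm (\<theta> n \<omega> - \<theta>star) ^ (2 * Suc q))) \<partial>M)"
      by (intro nn_integral_mono ennreal_leI le)
    also have "\<dots> = ennreal (expectation (\<lambda>\<omega>. S * (1 + norm (\<theta> n \<omega> - \<theta>star) ^ (2 * Suc q))))"
      using int S by (intro nn_integral_eq_integral AE_I2 mult_nonneg_nonneg) auto
    also have "expectation (\<lambda>\<omega>. S * (1 + norm (\<theta> n \<omega> - \<theta>star) ^ (2 * Suc q))) = S * (1 + u n)"
      using int unfolding u_def by (simp add: prob_space del: mult_Suc_right power_Suc)
    finally have *: "(\<integral>\<^sup>+\<omega>. ennreal (norm (\<Delta> n \<omega>) ^ (2 * Suc q)) \<partial>M) \<le> ennreal (S * (1 + u n))"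
      unfolding q .
    show **: "integrable M (\<lambda>\<omega>. norm (\<Delta> n \<omega>) ^ (2 * Suc q))"
      using * by (intro integrableI_nonneg) (auto simp: less_top[symmetric] top_unique simp del: mult_Suc_right power_Suc)
    show "expectation (\<lambda>\<omega>. norm (\<Delta> n \<omega>) ^ (2 * Suc q)) \<le> S * (1 + u n)"
      using * S u_nonneg[of n] unfolding nn_integral_eq_integral[OF ** AE_I2[OF zero_le_power[OF norm_ge_zero]]]
      by (subst (asm) ennreal_le_iff) auto
  qed

  have \<Lambda>_mean': "has_bochner_integral M (\<lambda>\<omega>. \<Lambda> (x, Z n \<omega>)) (gradient f x)" if n: "n \<ge> 1" for x n
  proof -
    have [measurable]: "Z n \<in> borel_measurable M" "Z 1 \<in> borel_measurable M" using n by auto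
    have "integrable (distr M borel (Z 1)) (\<lambda>z. \<Lambda> (x, z))"
      using \<Lambda>_mean[of x] by (subst integrable_distr_eq) (auto simp: has_bochner_integral_iff)
    then have "integrable (distr M borel (Z n)) (\<lambda>z. \<Lambda> (x, z))" using Z_ident[OF n] by simp
    then have "integrable M (\<lambda>\<omega>. \<Lambda> (x, Z n \<omega>))"
      by (subst (asm) integrable_distr_eq) auto
    moreover have "(\<integral>z. \<Lambda> (x, z) \<partial>distr M borel (Z n)) = (\<integral>z. \<Lambda> (x, z) \<partial>distr M borel (Z 1))"
      using Z_ident[OF n] by simp
    then have "expectation (\<lambda>\<omega>. \<Lambda> (x, Z n \<omega>)) = expectation (\<lambda>\<omega>. \<Lambda> (x, Z 1 \<omega>))"
      by (simp add: integral_distr)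
    ultimately show ?thesis using \<Lambda>_mean[of x] by (simp add: has_bochner_integral_iff)
  qed

  \<comment> \<open>The crude growth bound is used since early steps need not be small enough for
    contraction.\<close>
  have Y_int: "integrable M (\<lambda>\<omega>. norm (Y n (\<theta> n \<omega>)) ^ (2 * Suc q))"
    if int: "integrable M (\<lambda>\<omega>. norm (\<theta> n \<omega> - \<theta>star) ^ (2 * Suc q))" for n
  proof (rule Bochner_Integration.integrable_bound)
    let ?K = "1 + \<gamma> (Suc n) * L"
    show "integrable M (\<lambda>\<omega>. ?K ^ (2 * Suc q) * norm (\<theta> n \<omega> - \<theta>star) ^ (2 * Suc q))"
      using int by (rule integrable_mult_right)
    show "AE \<omega> in M. norm (norm (Y n (\<theta> n \<omega>)) ^ (2 * Suc q))
        \<le> norm (?K ^ (2 * Suc q) * norm (\<theta> n \<omega> - \<theta>star) ^ (2 * Suc q))"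
    proof (rule AE_I2)
      fix \<omega>
      have "norm (Y n (\<theta> n \<omega>)) ^ (2 * Suc q) \<le> (?K * norm (\<theta> n \<omega> - \<theta>star)) ^ (2 * Suc q)"
        unfolding Y_def
        using gradient_step_bounds(1)[OF \<gamma>_pos[of "Suc n"] _ lip mono] L by (intro power_mono) auto
      then show "norm (norm (Y n (\<theta> n \<omega>)) ^ (2 * Suc q))
        \<le> norm (?K ^ (2 * Suc q) * norm (\<theta> n \<omega> - \<theta>star) ^ (2 * Suc q))"
        by (simp add: power_mult_distrib power_abs del: mult_Suc_right power_Suc)
    qed
  qed measurable

  have cross_zero: "expectation (\<lambda>\<omega>. norm (Y n (\<theta> n \<omega>)) ^ (2 * q) * (Y n (\<theta> n \<omega>) \<bullet> \<Delta> n \<omega>)) = 0"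
    if int: "integrable M (\<lambda>\<omega>. norm (\<theta> n \<omega> - \<theta>star) ^ (2 * Suc q))" for n
  proof -
    define h where "h x z = norm (Y n x) ^ (2 * q) * (Y n x \<bullet> (gradient f x - \<Lambda> (x, z)))" for x z
    have "integrable M (\<lambda>\<omega>. norm (Y n (\<theta> n \<omega>)) ^ (2 * q) * (Y n (\<theta> n \<omega>) \<bullet> \<Delta> n \<omega>))"
      using Y_int[OF int] noise_moment(1)[OF int] by (intro integrable_norm_power_mult_inner) auto
    then have "integrable M (\<lambda>\<omega>. h (sgd \<Lambda> \<gamma> Z \<theta>\<^sub>0 n \<omega>) (Z (Suc n) \<omega>))"
      unfolding h_def \<Delta> unfolding \<theta> .
    then have "expectation (\<lambda>\<omega>. h (sgd \<Lambda> \<gamma> Z \<theta>\<^sub>0 n \<omega>) (Z (Suc n) \<omega>)) = 0"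
    proof (rule expectation_sgd_eq_0[OF \<Lambda>_meas Z_indep, rotated])
      show "case_prod h \<in> borel_measurable (borel \<Otimes>\<^sub>M borel)" unfolding h_def by measurable
      \<comment> \<open>With x frozen, \<open>h\<close> is affine in the noise value of \<Lambda>,
        whose mean is the gradient at x.\<close>
      show "expectation (\<lambda>\<omega>. h x (Z (Suc n) \<omega>)) = 0" for x
      proof -
        have "has_bochner_integral M (\<lambda>\<omega>. h x (Z (Suc n) \<omega>))
            (norm (Y n x) ^ (2 * q) * (Y n x \<bullet> (gradient f x - gradient f x)))"
          unfolding h_def
          by (intro has_bochner_integral_mult_right has_bochner_integral_inner_right
                has_bochner_integral_diff \<Lambda>_mean')
             (simp_all add: has_bochner_integral_iff prob_space)
        then show ?thesis by (simp add: has_bochner_integral_iff)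
      qed
    qed
    then show ?thesis unfolding h_def \<Delta> unfolding \<theta> .
  qed

  \<comment> \<open>Budget for the rate \<alpha>: one quarter goes to Young's inequality here,
    another to the growth of the noise with u_n, and one half remains.\<close>
  obtain D where D: "D \<ge> 0" and one_step: "\<And>g (y :: real ^ 'd) m. 0 < g \<Longrightarrow> g \<le> c \<Longrightarrow>
       norm (y + g *\<^sub>R m) ^ (2 * Suc q) \<le> (1 + \<alpha> / 4 * g) * norm y ^ (2 * Suc q)
         + 2 * real (Suc q) * g * (norm y ^ (2 * q) * (y \<bullet> m)) + D * g ^ (q + 2) * norm m ^ (2 * Suc q)"
    using norm_power_add_le[of "\<alpha> / 4" c q] \<alpha>_pos c_pos by auto
  have moment: "integrable M (\<lambda>\<omega>. norm (\<theta> (Suc n) \<omega> - \<theta>star) ^ (2 * Suc q))"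
      "u (Suc n) \<le> (1 + \<alpha> / 4 * \<gamma> (Suc n)) * expectation (\<lambda>\<omega>. norm (Y n (\<theta> n \<omega>)) ^ (2 * Suc q))
        + D * \<gamma> (Suc n) ^ (q + 2) * expectation (\<lambda>\<omega>. norm (\<Delta> n \<omega>) ^ (2 * Suc q))"
    if int: "integrable M (\<lambda>\<omega>. norm (\<theta> n \<omega> - \<theta>star) ^ (2 * Suc q))" for n
    using moment_of_perturbed_step[OF _ _ Y_int[OF int] noise_moment(1)[OF int] cross_zero[OF int]
        one_step[OF \<gamma>_pos[of "Suc n"] \<gamma>_le[of "Suc n"]]]
    unfolding u_def step by auto
  have int: "integrable M (\<lambda>\<omega>. norm (\<theta> n \<omega> - \<theta>star) ^ (2 * Suc q))" for n
  proof (induction n)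
    case 0
    show ?case by (simp add: \<theta> del: mult_Suc_right power_Suc)
  qed (rule moment)

  have small_step: "\<forall>\<^sub>F n in sequentially. \<gamma> (Suc n) < \<epsilon>" if "\<epsilon> > 0" for \<epsilon>
  proof -
    have "((\<lambda>n. c * real (Suc n) powr (- \<beta>)) \<longlongrightarrow> 0) sequentially"
      using \<beta> by (simp only: greaterThanLessThan_iff) real_asymp
    then have "\<forall>\<^sub>F n in sequentially. c * real (Suc n) powr (- \<beta>) < \<epsilon>"
      using that by (rule order_tendstoD)
    then show ?thesis using \<gamma> by simp
  qed
  have rec: "\<forall>\<^sub>F n in sequentially. u (Suc n) \<le> (1 - \<alpha> / 2 * \<gamma> (Suc n)) * u n + D * S * \<gamma> (Suc n) ^ Suc p"
  proof -
    \<comment> \<open>The first two thresholds make the gradient step contract. The third makes D S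
      g^(q+2) at most (\<alpha> / 4) g, using g^q <= c^q; the added 1 keeps its denominator
      positive.\<close>
    have "\<forall>\<^sub>F n in sequentially. \<gamma> (Suc n) < \<alpha> / L\<^sup>2"
      "\<forall>\<^sub>F n in sequentially. \<gamma> (Suc n) < 1 / \<alpha>"
      "\<forall>\<^sub>F n in sequentially. \<gamma> (Suc n) < \<alpha> / 4 / (D * S * c ^ q + 1)"
      using \<alpha>_pos L D S c_pos by (auto intro!: small_step divide_pos_pos add_nonneg_pos)
    then show ?thesis
    proof eventually_elim
      case (elim n)
      define g where "g = \<gamma> (Suc n)"
      have g: "0 < g" "g \<le> c" using \<gamma>_pos \<gamma>_le by (simp_all add: g_def)
      have g1: "g * L\<^sup>2 \<le> \<alpha>" using elim(1) L by (simp add: g_def field_simps)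
      have g2: "\<alpha> * g \<le> 1" using elim(2) \<alpha>_pos by (simp add: g_def field_simps)
      have g3: "D * S * g ^ (q + 2) \<le> \<alpha> / 4 * g"
      proof -
        have pos: "0 \<le> D * S * c ^ q" using D S c_pos by simp
        have "D * S * g ^ (q + 2) = (D * S * g ^ q * g) * g" by simp
        also have "\<dots> \<le> (D * S * c ^ q * g) * g"
          using g D S by (intro mult_right_mono mult_left_mono power_mono) auto
        also have "D * S * c ^ q * g \<le> (D * S * c ^ q + 1) * g"
          using g by (intro mult_right_mono) auto
        also have "\<dots> \<le> \<alpha> / 4" using elim(3) pos by (simp add: g_def pos_less_divide_eq algebra_simps)
        finally show ?thesis using g by simp
      qed
      have "expectation (\<lambda>\<omega>. norm (Y n (\<theta> n \<omega>)) ^ (2 * Suc q))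
          \<le> expectation (\<lambda>\<omega>. (1 - \<alpha> * g) * norm (\<theta> n \<omega> - \<theta>star) ^ (2 * Suc q))"
        using gradient_step_bounds(2)[OF g(1) _ lip mono g1 g2] L \<alpha>_pos
        by (intro integral_mono Y_int int integrable_mult_right) (auto simp: Y_def g_def)
      then have EY: "expectation (\<lambda>\<omega>. norm (Y n (\<theta> n \<omega>)) ^ (2 * Suc q)) \<le> (1 - \<alpha> * g) * u n"
        by (simp add: u_def del: mult_Suc_right power_Suc)
      have "u (Suc n) \<le> (1 + \<alpha> / 4 * g) * expectation (\<lambda>\<omega>. norm (Y n (\<theta> n \<omega>)) ^ (2 * Suc q))
        + D * g ^ (q + 2) * expectation (\<lambda>\<omega>. norm (\<Delta> n \<omega>) ^ (2 * Suc q))"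
        unfolding g_def by (rule moment(2)[OF int])
      also have "\<dots> \<le> (1 + \<alpha> / 4 * g) * ((1 - \<alpha> * g) * u n) + D * g ^ (q + 2) * (S * (1 + u n))"
        using g D \<alpha>_pos by (intro add_mono mult_left_mono EY noise_moment int) auto
      also have "\<dots> = ((1 + \<alpha> / 4 * g) * (1 - \<alpha> * g) + D * S * g ^ (q + 2)) * u n + D * S * g ^ (q + 2)"
      proof -
        have "A * (B * U) + D * G * (S * (1 + U)) = (A * B + D * S * G) * U + D * S * G" for A B G U :: real
          by (simp add: algebra_simps)
        then show ?thesis .
      qed
      also have "\<dots> \<le> ((1 + \<alpha> / 4 * g) * (1 - \<alpha> * g) + \<alpha> / 4 * g) * u n + D * S * g ^ (q + 2)"
        by (rule add_right_mono, rule mult_right_mono, rule add_left_mono, rule g3, rule u_nonneg)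
      \<comment> \<open>The leftover square is nonpositive and is dropped next, leaving the
        contraction rate \<alpha> / 2.\<close>
      also have "(1 + \<alpha> / 4 * g) * (1 - \<alpha> * g) + \<alpha> / 4 * g = 1 - \<alpha> / 2 * g - (\<alpha> * g)\<^sup>2 / 4"
        by (simp add: power2_eq_square field_simps)
      also have "(1 - \<alpha> / 2 * g - (\<alpha> * g)\<^sup>2 / 4) * u n \<le> (1 - \<alpha> / 2 * g) * u n"
        using u_nonneg by (intro mult_right_mono) auto
      finally show ?case by (simp add: g_def q)
    qed
  qed
  have "\<exists>C\<ge>0. \<forall>n\<ge>1. u n \<le> C * \<gamma> n ^ p"
    using \<beta> \<alpha>_pos D S by (intro recursive_bound_powr_steps[OF \<gamma> c_pos _ _ _ _ rec]) auto
  then obtain C where C: "C \<ge> 0" "\<And>n. n \<ge> 1 \<Longrightarrow> u n \<le> C * \<gamma> n ^ p" by blast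

  show ?thesis
  \<comment> \<open>Passage from exponent 2p to p. With G^2 = \<gamma>_n^p, the order of u_n, the
    bound (G + u_n / G) / 2 is at most (1 + C) G / 2.\<close>
  proof (intro exI[of _ "(1 + C) / 2"] allI impI)
    fix n :: nat assume n: "n \<ge> 1"
    define G where "G = \<gamma> n powr (real p / 2)"
    have G: "G > 0" "G * G = \<gamma> n ^ p"
      using \<gamma>_pos[OF n] by (simp_all add: G_def powr_add[symmetric] powr_realpow)
    define X where "X \<omega> = norm (\<theta> n \<omega> - \<theta>star) ^ p" for \<omega>
    have X2: "norm (\<theta> n \<omega> - \<theta>star) ^ (2 * Suc q) = (X \<omega>)\<^sup>2" for \<omega>
      unfolding X_def q by (rule power_even_eq)
    have X_meas [measurable]: "X \<in> borel_measurable M" unfolding X_def by measurable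
    have X0: "0 \<le> X \<omega>" for \<omega> by (simp add: X_def)
    \<comment> \<open>AM-GM in place of the Cauchy-Schwarz inequality for the expectation\<close>
    have amgm: "X \<omega> \<le> (G + (X \<omega>)\<^sup>2 / G) / 2" for \<omega>
    proof -
      have "0 \<le> (X \<omega> - G)\<^sup>2" by simp
      then have "2 * G * X \<omega> \<le> G * G + (X \<omega>)\<^sup>2" by (simp add: power2_eq_square algebra_simps)
      then show ?thesis using G(1) by (simp add: field_simps)
    qed
    have X2_int: "integrable M (\<lambda>\<omega>. (X \<omega>)\<^sup>2)" and X2_exp: "expectation (\<lambda>\<omega>. (X \<omega>)\<^sup>2) = u n"
      using int[of n] by (simp_all only: u_def X2)
    have bound_int: "integrable M (\<lambda>\<omega>. (G + (X \<omega>)\<^sup>2 / G) / 2)" using X2_int by simp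
    have X_int: "integrable M X"
    proof (rule Bochner_Integration.integrable_bound[OF bound_int])
      show "AE \<omega> in M. norm (X \<omega>) \<le> norm ((G + (X \<omega>)\<^sup>2 / G) / 2)"
      proof (rule AE_I2)
        fix \<omega>
        show "norm (X \<omega>) \<le> norm ((G + (X \<omega>)\<^sup>2 / G) / 2)"
          using amgm[of \<omega>] X0[of \<omega>] unfolding real_norm_def by linarith
      qed
    qed measurable
    have "expectation X \<le> expectation (\<lambda>\<omega>. (G + (X \<omega>)\<^sup>2 / G) / 2)"
      by (rule integral_mono[OF X_int bound_int amgm])
    also have "\<dots> = (G + u n / G) / 2"
      using X2_int by (simp add: X2_exp prob_space)
    also have "\<dots> \<le> (G + C * G) / 2"
      using C(2)[OF n] G by (simp add: pos_divide_le_eq mult.assoc)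
    finally have "expectation X \<le> (1 + C) / 2 * G" by (simp add: algebra_simps)
    with X_int show "integrable M (\<lambda>\<omega>. norm (\<theta> n \<omega> - \<theta>star) ^ p) \<and>
        expectation (\<lambda>\<omega>. norm (\<theta> n \<omega> - \<theta>star) ^ p) \<le> (1 + C) / 2 * \<gamma> n powr (real p / 2)"
      unfolding X_def G_def by simp
  qed
qed

end
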